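(* Let $d\ge3$, let $T_n$ be the regular $d$-ary rooted tree of level $n$, and let $E_{n,\mathrm{fix}}\subseteq E_n$ be the set of elements of $E_n\subseteq\mathrm{Aut}(T_n)$ that fix a leaf (a vertex at level $n$) of $T_n$. Then $$\frac{|E_{n,\mathrm{fix}}|}{|E_n|}\to0\quad\text{as } n\to\infty.$$
   Context: $T_n$ has levels $0,\dots,n$, every vertex at level $<n$ having $d$ children; vertices at level $i$ are labeled $(\ell_1,\dots,\ell_i)$, $\ell_j\in\{1,\dots,d\}$. Permutations act from the right. One has $\mathrm{Aut}(T_1)= S_d$ and $\mathrm{Aut}(T_n)\simeq \mathrm{Aut}(T_{n-1})\wr\mathrm{Aut}(T_1)$, with elements written $((\sigma_1,\dots,\sigma_d),\tau)$, $\sigma_j\in\mathrm{Aut}(T_{n-1})$, $\tau\in S_d$, acting by $(\ell_1,\dots,\ell_n)\mapsto((\ell_1)\tau,(\ell_2,\dots,\ell_n)\sigma_{\ell_1})$. For $H\le\mathrm{Aut}(T_{n-1})$ and $S\le S_d$, $H\wr S$ is the group of all such elements with all $\sigma_j\in H$ and $\tau\in S$. The wreath-product sign $\mathrm{sgn}_2:\mathrm{Aut}(T_2)\to\{\pm1\}$ is $\mathrm{sgn}_2((\sigma_1,\dots,\sigma_d),\tau)=\mathrm{sgn}(\tau)\prod_i\mathrm{sgn}(\sigma_i)$; for $n>2$, $\mathrm{sgn}_2$ on $\mathrm{Aut}(T_n)$ is the composition with the restriction map $\mathrm{Aut}(T_n)\to\mathrm{Aut}(T_2)$. Define $E_1=\mathrm{Aut}(T_1)$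 and $E_n=(E_{n-1}\wr E_1)\cap\ker(\mathrm{sgn}_2)\subseteq\mathrm{Aut}(T_n)$ for $n\ge2$. *)

theory Defs
  imports Complex_Main "HOL-Combinatorics.Permutations"
begin

text \<open>
  The vertex labelled \<open>(l\<^sub>1, \<dots>, l\<^sub>i)\<close> is the list \<open>[l\<^sub>1, \<dots>, l\<^sub>i]\<close>; the root is \<open>[]\<close>.
\<close>

definition tree_verts :: "nat \<Rightarrow> nat \<Rightarrow> nat list set" where
  "tree_verts d n = {v. length v \<le> n \<and> set v \<subseteq> {1..d}}"

definition leaves :: "nat \<Rightarrow> nat \<Rightarrow> nat list set" where
  "leaves d n = {v \<in> tree_verts d n. length v = n}"

definition tree_adj :: "nat list \<Rightarrow> nat list \<Rightarrow> bool" where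
  "tree_adj u v \<longleftrightarrow> (\<exists>l. v = u @ [l]) \<or> (\<exists>l. u = v @ [l])"

text \<open>
  As usual with \<^const>\<open>permutes\<close>, an automorphism is extended by the identity outside the
  vertex set, so that distinct automorphisms are distinct functions and cardinalities are right.
\<close>

definition tree_aut :: "nat \<Rightarrow> nat \<Rightarrow> (nat list \<Rightarrow> nat list) set" where
  "tree_aut d n = {g. g permutes tree_verts d n \<and> g [] = [] \<and>
     (\<forall>u\<in>tree_verts d n. \<forall>v\<in>tree_verts d n. tree_adj (g u) (g v) \<longleftrightarrow> tree_adj u v)}"

text \<open>
  The element \<open>((\<sigma> 1, \<dots>, \<sigma> d), \<tau>)\<close>, as a permutation of the vertices of the tree of level
  \<open>Suc n\<close>, where each \<open>\<sigma> l\<close> is an automorphism of the tree of level \<open>n\<close>.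
\<close>

definition wreath_elt ::
    "nat \<Rightarrow> nat \<Rightarrow> (nat \<Rightarrow> nat list \<Rightarrow> nat list) \<Rightarrow> (nat \<Rightarrow> nat) \<Rightarrow> nat list \<Rightarrow> nat list" where
  "wreath_elt d n \<sigma> \<tau> w =
     (if w \<in> tree_verts d (Suc n) then (case w of [] \<Rightarrow> [] | l # v \<Rightarrow> \<tau> l # \<sigma> l v) else w)"

definition wreath ::
    "nat \<Rightarrow> nat \<Rightarrow> (nat list \<Rightarrow> nat list) set \<Rightarrow> (nat \<Rightarrow> nat) set \<Rightarrow> (nat list \<Rightarrow> nat list) set" where
  "wreath d n H S = {wreath_elt d n \<sigma> \<tau> | \<sigma> \<tau>. (\<forall>l\<in>{1..d}. \<sigma> l \<in> H) \<and> \<tau> \<in> S}"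

text \<open>
  The coordinates \<open>\<tau>\<close> and \<open>\<sigma>\<^sub>l\<close> of an automorphism; on the tree of level 1, \<open>root_perm\<close> is the
  identification of the automorphism group with the symmetric group on \<open>{1..d}\<close>.
\<close>

definition root_perm :: "nat \<Rightarrow> (nat list \<Rightarrow> nat list) \<Rightarrow> nat \<Rightarrow> nat" where
  "root_perm d g l = (if l \<in> {1..d} then hd (g [l]) else l)"

definition section_at ::
    "nat \<Rightarrow> nat \<Rightarrow> (nat list \<Rightarrow> nat list) \<Rightarrow> nat \<Rightarrow> nat list \<Rightarrow> nat list" where
  "section_at d n g l v = (if v \<in> tree_verts d n then tl (g (l # v)) else v)"

definition restrict_aut :: "nat \<Rightarrow> nat \<Rightarrow> (nat list \<Rightarrow> nat list) \<Rightarrow> nat list \<Rightarrow> nat list" where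
  "restrict_aut d m g v = (if v \<in> tree_verts d m then g v else v)"

definition sgn2_level2 :: "nat \<Rightarrow> (nat list \<Rightarrow> nat list) \<Rightarrow> int" where
  "sgn2_level2 d g = sign (root_perm d g) * (\<Prod>i\<in>{1..d}. sign (root_perm d (section_at d 1 g i)))"

definition sgn2 :: "nat \<Rightarrow> (nat list \<Rightarrow> nat list) \<Rightarrow> int" where
  "sgn2 d g = sgn2_level2 d (restrict_aut d 2 g)"

text \<open>The groups are defined for levels at least 1; the value at level 0 is a dummy.\<close>

fun E_group :: "nat \<Rightarrow> nat \<Rightarrow> (nat list \<Rightarrow> nat list) set" where
  "E_group d 0 = tree_aut d 0"
| "E_group d (Suc 0) = tree_aut d 1"
| "E_group d (Suc (Suc n)) =
     wreath d (Suc n) (E_group d (Suc n)) (root_perm d ` E_group d (Suc 0))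
       \<inter> {g \<in> tree_aut d (Suc (Suc n)). sgn2 d g = 1}"

definition E_fix :: "nat \<Rightarrow> nat \<Rightarrow> (nat list \<Rightarrow> nat list) set" where
  "E_fix d n = {g \<in> E_group d n. \<exists>v\<in>leaves d n. g v = v}"

lemma tree_verts_Cons_iff:
  "l # v \<in> tree_verts d (Suc n) \<longleftrightarrow> l \<in> {1..d} \<and> v \<in> tree_verts d n"
  by (auto simp: tree_verts_def)

lemma Nil_in_tree_verts: "[] \<in> tree_verts d n"
  by (simp add: tree_verts_def)

lemma tree_adj_Cons_iff:
  "tree_adj (k # u) (l # v) \<longleftrightarrow> k = l \<and> tree_adj u v"
  by (auto simp: tree_adj_def)

lemma tree_adj_Nil_iff: "tree_adj [] (l # v) \<longleftrightarrow> v = []" "tree_adj (l # v) [] \<longleftrightarrow> v = []"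
  by (auto simp: tree_adj_def)

lemma tree_aut_in_verts: "g \<in> tree_aut d n \<Longrightarrow> g v \<in> tree_verts d n \<longleftrightarrow> v \<in> tree_verts d n"
  by (auto simp: tree_aut_def permutes_in_image)

lemma tree_aut_inj: "g \<in> tree_aut d n \<Longrightarrow> g u = g v \<longleftrightarrow> u = v"
  unfolding tree_aut_def by (auto dest: permutes_inj simp: inj_eq)

lemma tree_aut_Nil: "g \<in> tree_aut d n \<Longrightarrow> g [] = []"
  by (simp add: tree_aut_def)

lemma tree_aut_adj:
  "g \<in> tree_aut d n \<Longrightarrow> u \<in> tree_verts d n \<Longrightarrow> v \<in> tree_verts d n \<Longrightarrow>
    tree_adj (g u) (g v) \<longleftrightarrow> tree_adj u v"
  by (simp add: tree_aut_def)

lemma tree_aut_snoc: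
  assumes g: "g \<in> tree_aut d n" and "v @ [l] \<in> tree_verts d n"
  shows "\<exists>k. g (v @ [l]) = g v @ [k]"
  using assms(2)
proof (induction v arbitrary: l rule: rev_induct)
  case Nil
  have "tree_adj (g []) (g [l])"
    using tree_aut_adj[OF g Nil_in_tree_verts, of "[l]"] Nil by (simp add: tree_adj_Nil_iff)
  then show ?case using tree_aut_Nil[OF g] by (simp add: tree_adj_def)
next
  case (snoc m v)
  have V: "v @ [m] \<in> tree_verts d n" "v @ [m, l] \<in> tree_verts d n"
    using snoc.prems by (auto simp: tree_verts_def)
  obtain k where k: "g (v @ [m]) = g v @ [k]" using snoc.IH V by blast
  have "tree_adj (v @ [m]) (v @ [m, l])" by (auto simp: tree_adj_def)
  then have "tree_adj (g (v @ [m])) (g (v @ [m, l]))"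
    using tree_aut_adj[OF g] V by blast
  moreover have "g (v @ [m, l]) \<noteq> g v" using tree_aut_inj[OF g] by auto
  ultimately show ?case using k by (auto simp: tree_adj_def)
qed

lemma tree_aut_Cons:
  assumes g: "g \<in> tree_aut d (Suc n)" and "l # v \<in> tree_verts d (Suc n)"
  shows "g (l # v) = root_perm d g l # section_at d n g l v"
  using assms(2)
proof (induction v rule: rev_induct)
  case Nil
  then show ?case
    using tree_aut_snoc[OF g, of "[]" l] tree_aut_Nil[OF g]
    by (auto simp: root_perm_def section_at_def Nil_in_tree_verts tree_verts_Cons_iff)
next
  case (snoc m v)
  have "l # v \<in> tree_verts d (Suc n)" using snoc.prems by (auto simp: tree_verts_def)
  then obtain w where w: "g (l # v) = root_perm d g l # w" using snoc.IH by blast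
  obtain k where "g (l # v @ [m]) = g (l # v) @ [k]"
    using tree_aut_snoc[OF g, of "l # v" m] snoc.prems by auto
  then have "g (l # v @ [m]) = root_perm d g l # w @ [k]" using w by simp
  then show ?case using snoc.prems by (simp add: section_at_def tree_verts_Cons_iff)
qed

lemma finite_tree_verts: "finite (tree_verts d n)"
proof -
  have "tree_verts d n = {v. set v \<subseteq> {1..d} \<and> length v \<le> n}" by (auto simp: tree_verts_def)
  then show ?thesis by (simp add: finite_lists_length_le)
qed

lemma permutes_finite_injI:
  assumes "finite A" "\<And>x. x \<in> A \<Longrightarrow> f x \<in> A" "inj_on f A" "\<And>x. x \<notin> A \<Longrightarrow> f x = x"
  shows "f permutes A"
proof (rule bij_imp_permutes)
  show "bij_betw f A A"
    using assms(1-3) endo_inj_surj[of A f] by (simp add: bij_betw_def image_subset_iff)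
qed (use assms(4) in simp)

lemma root_perm_permutes:
  assumes g: "g \<in> tree_aut d (Suc n)"
  shows "root_perm d g permutes {1..d}"
proof (rule permutes_finite_injI)
  have V: "l # [] \<in> tree_verts d (Suc n)" if "l \<in> {1..d}" for l
    using that by (simp add: tree_verts_def)
  have eq: "g [l] = [root_perm d g l]" if "l \<in> {1..d}" for l
    using tree_aut_snoc[OF g, of "[]" l] V[OF that] that tree_aut_Nil[OF g]
    by (auto simp: root_perm_def)
  show "root_perm d g l \<in> {1..d}" if "l \<in> {1..d}" for l
    using tree_aut_in_verts[OF g, of "[l]"] V[OF that] eq[OF that]
    by (simp add: tree_verts_Cons_iff)
  show "inj_on (root_perm d g) {1..d}"
    by (rule inj_onI) (metis eq tree_aut_inj[OF g] list.inject)
qed (auto simp: root_perm_def)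

lemma section_at_tree_aut:
  assumes g: "g \<in> tree_aut d (Suc n)" and l: "l \<in> {1..d}"
  shows "section_at d n g l \<in> tree_aut d n"
proof -
  have eq: "g (l # v) = root_perm d g l # section_at d n g l v" if "v \<in> tree_verts d n" for v
    using tree_aut_Cons[OF g] that l by (simp add: tree_verts_Cons_iff)
  have "section_at d n g l permutes tree_verts d n"
  proof (rule permutes_finite_injI[OF finite_tree_verts])
    show "section_at d n g l v \<in> tree_verts d n" if v: "v \<in> tree_verts d n" for v
      using tree_aut_in_verts[OF g, of "l # v"] eq[OF v] v l by (simp add: tree_verts_Cons_iff)
    show "inj_on (section_at d n g l) (tree_verts d n)"
      by (rule inj_onI) (metis eq tree_aut_inj[OF g] list.inject)
  qed (auto simp: section_at_def)
  moreover have "section_at d n g l [] = []"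
    using tree_aut_snoc[OF g, of "[]" l] l tree_aut_Nil[OF g]
    by (auto simp: section_at_def Nil_in_tree_verts tree_verts_Cons_iff)
  moreover have "tree_adj (section_at d n g l u) (section_at d n g l v) \<longleftrightarrow> tree_adj u v"
    if "u \<in> tree_verts d n" "v \<in> tree_verts d n" for u v
  proof -
    have "tree_adj (g (l # u)) (g (l # v)) \<longleftrightarrow> tree_adj (l # u) (l # v)"
      by (rule tree_aut_adj[OF g]) (use that l in \<open>simp_all add: tree_verts_Cons_iff\<close>)
    then show ?thesis using eq that by (simp add: tree_adj_Cons_iff)
  qed
  ultimately show ?thesis by (simp add: tree_aut_def)
qed

lemma wreath_elt_tree_aut:
  assumes s: "\<And>l. l \<in> {1..d} \<Longrightarrow> \<sigma> l \<in> tree_aut d n" and t: "\<tau> permutes {1..d}"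
  shows "wreath_elt d n \<sigma> \<tau> \<in> tree_aut d (Suc n)"
proof -
  let ?g = "wreath_elt d n \<sigma> \<tau>"
  have Nil: "?g [] = []" by (simp add: wreath_elt_def)
  have eq: "?g (l # v) = \<tau> l # \<sigma> l v" if "l \<in> {1..d}" "v \<in> tree_verts d n" for l v
    using that by (simp add: wreath_elt_def tree_verts_Cons_iff)
  have tl: "\<tau> l = \<tau> k \<longleftrightarrow> l = k" for l k using permutes_inj[OF t] by (rule inj_eq)
  have snil: "\<sigma> l [] = []" if "l \<in> {1..d}" for l using s[OF that] by (simp add: tree_aut_def)
  have snil': "\<sigma> l v = [] \<longleftrightarrow> v = []" if "l \<in> {1..d}" for l v
    using tree_aut_inj[OF s[OF that], of v "[]"] snil[OF that] by simp
  have "?g permutes tree_verts d (Suc n)"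
  proof (rule permutes_finite_injI[OF finite_tree_verts])
    show "?g v \<in> tree_verts d (Suc n)" if v: "v \<in> tree_verts d (Suc n)" for v
    proof (cases v)
      case (Cons l w)
      then show ?thesis using v eq tree_aut_in_verts[OF s] permutes_in_image[OF t]
        by (simp add: tree_verts_Cons_iff del: atLeastAtMost_iff)
    qed (simp add: Nil Nil_in_tree_verts)
    show "inj_on ?g (tree_verts d (Suc n))"
    proof (rule inj_onI)
      fix u v assume uv: "u \<in> tree_verts d (Suc n)" "v \<in> tree_verts d (Suc n)" "?g u = ?g v"
      show "u = v"
      proof (cases u)
        case u: Nil
        show ?thesis
        proof (cases v)
          case (Cons l v')
          then show ?thesis using uv u eq[of l v'] Nil by (simp add: tree_verts_Cons_iff)
        qed (use u in simp)
      next
        case u: (Cons k u')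
        show ?thesis
        proof (cases v)
          case v: Nil
          then show ?thesis using uv u eq[of k u'] Nil by (simp add: tree_verts_Cons_iff)
        next
          case v: (Cons l v')
          have A: "k \<in> {1..d}" "l \<in> {1..d}" "u' \<in> tree_verts d n" "v' \<in> tree_verts d n"
            using uv u v by (simp_all only: tree_verts_Cons_iff)
          have "\<tau> k = \<tau> l" "\<sigma> k u' = \<sigma> l v'"
            using uv(3) eq[OF A(1,3)] eq[OF A(2,4)] u v by simp_all
          then show ?thesis using tl tree_aut_inj[OF s[OF A(1)]] u v by simp
        qed
      qed
    qed
  qed (auto simp: wreath_elt_def)
  moreover have "tree_adj (?g u) (?g v) \<longleftrightarrow> tree_adj u v"
    if uv: "u \<in> tree_verts d (Suc n)" "v \<in> tree_verts d (Suc n)" for u v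
  proof (cases u)
    case u: Nil
    show ?thesis
    proof (cases v)
      case v: (Cons l v')
      have A: "l \<in> {1..d}" "v' \<in> tree_verts d n"
        using uv v by (simp_all only: tree_verts_Cons_iff)
      show ?thesis using u v Nil eq[OF A] snil'[OF A(1)] by (simp add: tree_adj_Nil_iff)
    qed (use u Nil in simp)
  next
    case u: (Cons k u')
    have A: "k \<in> {1..d}" "u' \<in> tree_verts d n"
      using uv u by (simp_all only: tree_verts_Cons_iff)
    show ?thesis
    proof (cases v)
      case v: Nil
      show ?thesis using u v Nil eq[OF A] snil'[OF A(1)] by (simp add: tree_adj_Nil_iff)
    next
      case v: (Cons l v')
      have B: "l \<in> {1..d}" "v' \<in> tree_verts d n"
        using uv v by (simp_all only: tree_verts_Cons_iff)
      have "tree_adj (?g u) (?g v) \<longleftrightarrow> k = l \<and> tree_adj (\<sigma> k u') (\<sigma> l v')"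
        using eq[OF A] eq[OF B] u v by (simp add: tree_adj_Cons_iff tl)
      also have "\<dots> \<longleftrightarrow> k = l \<and> tree_adj u' v'"
        using tree_aut_adj[OF s[OF A(1)] A(2) B(2)] by auto
      finally show ?thesis using u v by (simp add: tree_adj_Cons_iff)
    qed
  qed
  ultimately show ?thesis using Nil by (simp add: tree_aut_def)
qed

lemma tree_aut_not_in: "g \<in> tree_aut d n \<Longrightarrow> v \<notin> tree_verts d n \<Longrightarrow> g v = v"
  by (auto simp: tree_aut_def intro: permutes_not_in)

lemma root_perm_wreath_elt:
  assumes "\<tau> permutes {1..d}"
  shows "root_perm d (wreath_elt d n \<sigma> \<tau>) = \<tau>"
proof
  fix l
  show "root_perm d (wreath_elt d n \<sigma> \<tau>) l = \<tau> l"
    using permutes_not_in[OF assms, of l]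
    by (simp add: root_perm_def wreath_elt_def tree_verts_Cons_iff Nil_in_tree_verts)
qed

lemma section_at_wreath_elt:
  assumes "\<sigma> l \<in> tree_aut d n" "l \<in> {1..d}"
  shows "section_at d n (wreath_elt d n \<sigma> \<tau>) l = \<sigma> l"
proof
  fix v
  show "section_at d n (wreath_elt d n \<sigma> \<tau>) l v = \<sigma> l v"
    using tree_aut_not_in[OF assms(1), of v] assms(2)
    by (simp add: section_at_def wreath_elt_def tree_verts_Cons_iff)
qed

theorem tree_aut_Suc: "tree_aut d (Suc n) = wreath d n (tree_aut d n) {\<tau>. \<tau> permutes {1..d}}"
proof (intro equalityI subsetI)
  fix g assume g: "g \<in> tree_aut d (Suc n)"
  have "g w = wreath_elt d n (section_at d n g) (root_perm d g) w" for w
  proof (cases "w \<in> tree_verts d (Suc n)")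
    case True
    moreover have "g [] = []" using g by (simp add: tree_aut_def)
    ultimately show ?thesis using tree_aut_Cons[OF g]
      by (cases w) (simp_all add: wreath_elt_def)
  next
    case False
    then show ?thesis using tree_aut_not_in[OF g] by (simp add: wreath_elt_def)
  qed
  then have "g = wreath_elt d n (section_at d n g) (root_perm d g)" by (rule ext)
  moreover have "\<forall>l\<in>{1..d}. section_at d n g l \<in> tree_aut d n"
    using section_at_tree_aut[OF g] by blast
  ultimately show "g \<in> wreath d n (tree_aut d n) {\<tau>. \<tau> permutes {1..d}}"
    using root_perm_permutes[OF g] unfolding wreath_def mem_Collect_eq by blast
next
  fix g assume "g \<in> wreath d n (tree_aut d n) {\<tau>. \<tau> permutes {1..d}}"
  then obtain \<sigma> \<tau> where "g = wreath_elt d n \<sigma> \<tau>" "\<forall>l\<in>{1..d}. \<sigma> l \<in> tree_aut d n"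
    "\<tau> permutes {1..d}" unfolding wreath_def by blast
  then show "g \<in> tree_aut d (Suc n)" using wreath_elt_tree_aut by blast
qed

theorem root_perm_bij: "bij_betw (root_perm d) (tree_aut d 1) {\<tau>. \<tau> permutes {1..d}}"
proof (rule bij_betw_byWitness[where f' = "wreath_elt d 0 (\<lambda>_. id)"])
  have id0: "id \<in> tree_aut d 0" by (simp add: tree_aut_def permutes_id)
  have id: "\<sigma> v = v" if "\<sigma> \<in> tree_aut d 0" for \<sigma> v
  proof (cases "v = []")
    case True
    then show ?thesis using that by (simp add: tree_aut_def)
  next
    case False
    then show ?thesis using tree_aut_not_in[OF that] by (simp add: tree_verts_def)
  qed
  show "\<forall>g\<in>tree_aut d 1. wreath_elt d 0 (\<lambda>_. id) (root_perm d g) = g"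
  proof
    fix g assume "g \<in> tree_aut d 1"
    then obtain \<sigma> \<tau> where g: "g = wreath_elt d 0 \<sigma> \<tau>" "\<forall>l\<in>{1..d}. \<sigma> l \<in> tree_aut d 0"
      "\<tau> permutes {1..d}"
      using tree_aut_Suc[of d 0] unfolding wreath_def One_nat_def by blast
    have "wreath_elt d 0 (\<lambda>_. id) \<tau> w = wreath_elt d 0 \<sigma> \<tau> w" for w
    proof (cases w)
      case (Cons l v)
      have "\<sigma> l v = v" if "l \<in> {1..d}" using g(2) that id by blast
      then show ?thesis using Cons by (simp add: wreath_elt_def tree_verts_Cons_iff)
    qed (simp add: wreath_elt_def)
    then show "wreath_elt d 0 (\<lambda>_. id) (root_perm d g) = g"
      using g by (auto simp: root_perm_wreath_elt)
  qed
  show "\<forall>\<tau>\<in>{\<tau>. \<tau> permutes {1..d}}. root_perm d (wreath_elt d 0 (\<lambda>_. id) \<tau>) = \<tau>"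
    by (auto intro: root_perm_wreath_elt)
  show "root_perm d ` tree_aut d 1 \<subseteq> {\<tau>. \<tau> permutes {1..d}}"
    using root_perm_permutes[of _ d 0] by auto
  show "wreath_elt d 0 (\<lambda>_. id) ` {\<tau>. \<tau> permutes {1..d}} \<subseteq> tree_aut d 1"
    using wreath_elt_tree_aut[of d "\<lambda>_. id" 0] id0 by auto
qed

lemma sgn2_level2_wreath_elt:
  assumes "\<And>l. l \<in> {1..d} \<Longrightarrow> \<sigma> l \<in> tree_aut d 1" and "\<tau> permutes {1..d}"
  shows "sgn2_level2 d (wreath_elt d 1 \<sigma> \<tau>) = sign \<tau> * (\<Prod>i\<in>{1..d}. sign (root_perm d (\<sigma> i)))"
proof -
  have "(\<Prod>i\<in>{1..d}. sign (root_perm d (section_at d 1 (wreath_elt d 1 \<sigma> \<tau>) i)) :: int) =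
        (\<Prod>i\<in>{1..d}. sign (root_perm d (\<sigma> i)))"
    by (rule prod.cong) (use assms in \<open>simp_all add: section_at_wreath_elt\<close>)
  then show ?thesis
    using assms unfolding sgn2_level2_def by (simp add: root_perm_wreath_elt)
qed

lemma restrict_aut_self: "g \<in> tree_aut d n \<Longrightarrow> restrict_aut d n g = g"
  by (rule ext) (simp add: restrict_aut_def tree_aut_not_in)

end

theory Submission
  imports Defs "HOL-Library.FuncSet"
begin

text \<open>
  Let \<open>x\<^sub>n\<close> be the proportion of elements of \<open>E\<^sub>n\<close> that fix a leaf. An element
  \<open>((\<sigma>\<^sub>1, \<dots>, \<sigma>\<^sub>d), \<tau>)\<close> fixes a leaf exactly when some \<open>i\<close> fixed by \<open>\<tau>\<close> has a section
  \<open>\<sigma>\<^sub>i\<close> that fixes one. Without the sign condition the coordinates would be independent and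
  uniform, and the expected value of \<open>(1 - x)\<close> to the number of fixed points of a random
  permutation would give
  \[ 1 - x_{n+1} = \sum_{k=0}^{d} \frac{(-x_n)^k}{k!} , \]
  a truncation of \<open>exp (- x)\<close>; hence \<open>x\<^sub>n\<close> would decrease by about \<open>x\<^sub>n\<^sup>2 / 2\<close> in each step and
  tend to \<open>0\<close>.

  The sign condition is inserted through its indicator \<open>(1 + s) / 2\<close>, where \<open>s\<close> is the product of
  the signs of \<open>\<tau>\<close> and of the root permutations of all \<open>\<sigma>\<^sub>i\<close> (\<^emph>\<open>sum_E_group_Suc\<close>). The part with
  \<open>s\<close> is small because root signs sum to zero over \<open>E\<^sub>n\<close> (\<^emph>\<open>sum_root_sign_E_group\<close>): whenever
  \<open>\<tau>\<close> moves a letter, the section there is unrestricted and its sum of signs vanishes. Only the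
  identity survives, and it contributes the error \<open>r\<^sup>d / d!\<close>, where \<open>r\<close> is the average root sign
  restricted to the elements fixing no leaf (\<^emph>\<open>fix_ratio_Suc\<close>). Again because the signs cancel
  over the whole group, \<open>\<bar>r\<bar> \<le> x\<^sub>n\<close>. For \<open>d \<ge> 3\<close> the error is thus at most \<open>x\<^sub>n\<^sup>3 / 6\<close>, and the
  cubic terms together, at most \<open>x\<^sub>n\<^sup>3 / 3\<close>, do not outweigh the gain \<open>x\<^sub>n\<^sup>2 / 2\<close>
  (\<^emph>\<open>fix_ratio_decay\<close>).
\<close>

section \<open>Permutations weighted by their fixed points\<close>

lemma sum_Pow_card:
  fixes f :: "nat \<Rightarrow> 'a::comm_semiring_1"
  assumes "finite A"
  shows "(\<Sum>S\<in>Pow A. f (card S)) = (\<Sum>k\<le>card A. of_nat (card A choose k) * f k)"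
proof -
  have "(\<Sum>S\<in>Pow A. f (card S)) = (\<Sum>k\<le>card A. \<Sum>S | S \<in> Pow A \<and> card S = k. f (card S))"
    using assms by (intro sum.group[symmetric]) (auto intro: card_mono)
  also have "\<dots> = (\<Sum>k\<le>card A. of_nat (card A choose k) * f k)"
    by (rule sum.cong) (use assms in \<open>simp_all add: n_subsets\<close>)
  finally show ?thesis .
qed

lemma card_permutes_fixing:
  assumes "finite A" "S \<subseteq> A"
  shows "card {\<tau>. \<tau> permutes A \<and> (\<forall>i\<in>S. \<tau> i = i)} = fact (card A - card S)"
proof -
  have "{\<tau>. \<tau> permutes A \<and> (\<forall>i\<in>S. \<tau> i = i)} = {\<tau>. \<tau> permutes (A - S)}"
  proof (intro Collect_cong iffI conjI)
    fix \<tau> assume "\<tau> permutes A \<and> (\<forall>i\<in>S. \<tau> i = i)"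
    then show "\<tau> permutes (A - S)" by (auto intro: permutes_superset)
  next
    fix \<tau> assume t: "\<tau> permutes (A - S)"
    then show "\<tau> permutes A" by (rule permutes_subset) auto
    show "\<forall>i\<in>S. \<tau> i = i" using permutes_not_in[OF t] by auto
  qed
  moreover have "card (A - S) = card A - card S"
    using assms by (simp add: card_Diff_subset finite_subset)
  ultimately show ?thesis using assms by (simp add: card_permutations)
qed

text \<open>
  The generating function of the number of fixed points. Expanding each product over the sets
  \<open>S\<close> of fixed points and exchanging the sums leaves the number \<open>(card A - card S)!\<close> of
  permutations fixing \<open>S\<close> pointwise; the \<open>card A choose k\<close> sets of size \<open>k\<close> turn this into
  \<open>(card A)! / k!\<close>.
\<close>

lemma sum_permutes_fixed_points:
  fixes y :: "'b::field_char_0"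
  assumes A: "finite A"
  shows "(\<Sum>\<tau> | \<tau> permutes A. \<Prod>i\<in>A. if \<tau> i = i then 1 + y else 1) =
    fact (card A) * (\<Sum>k\<le>card A. y ^ k / fact k)"
proof -
  let ?P = "{\<tau>. \<tau> permutes A}"
  have finP: "finite ?P" using A by (rule finite_permutations)
  have "(\<Prod>i\<in>A. if \<tau> i = i then 1 + y else 1) =
      (\<Sum>S\<in>Pow A. of_bool (\<forall>i\<in>S. \<tau> i = i) * y ^ card S)" for \<tau>
  proof -
    have "(\<Prod>i\<in>A. if \<tau> i = i then 1 + y else 1) = (\<Prod>i\<in>A. (if \<tau> i = i then y else 0) + 1)"
      by (rule prod.cong) auto
    also have "\<dots> = (\<Sum>S\<in>Pow A. \<Prod>i\<in>S. if \<tau> i = i then y else 0)"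
      using A by (simp add: prod_add)
    also have "\<dots> = (\<Sum>S\<in>Pow A. of_bool (\<forall>i\<in>S. \<tau> i = i) * y ^ card S)"
    proof (rule sum.cong[OF refl])
      fix S assume "S \<in> Pow A"
      then have S: "finite S" using A finite_subset by auto
      show "(\<Prod>i\<in>S. if \<tau> i = i then y else 0) = of_bool (\<forall>i\<in>S. \<tau> i = i) * y ^ card S"
      proof (cases "\<forall>i\<in>S. \<tau> i = i")
        case False
        then have "(\<Prod>i\<in>S. if \<tau> i = i then y else 0) = 0"
          using S by (auto simp: prod_zero_iff)
        then show ?thesis using False by simp
      qed simp
    qed
    finally show ?thesis .
  qed
  then have "(\<Sum>\<tau>\<in>?P. \<Prod>i\<in>A. if \<tau> i = i then 1 + y else 1) =
      (\<Sum>S\<in>Pow A. \<Sum>\<tau>\<in>?P. of_bool (\<forall>i\<in>S. \<tau> i = i) * y ^ card S)"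
    by (simp add: sum.swap[of _ ?P])
  also have "\<dots> = (\<Sum>S\<in>Pow A. fact (card A - card S) * y ^ card S)"
  proof (rule sum.cong[OF refl])
    fix S assume "S \<in> Pow A"
    then have "card (?P \<inter> {\<tau>. \<forall>i\<in>S. \<tau> i = i}) = fact (card A - card S)"
      using card_permutes_fixing[OF A, of S] by (simp add: Collect_conj_eq)
    then show "(\<Sum>\<tau>\<in>?P. of_bool (\<forall>i\<in>S. \<tau> i = i) * y ^ card S) =
        fact (card A - card S) * y ^ card S"
      using finP by (simp add: sum_distrib_right[symmetric])
  qed
  also have "\<dots> = (\<Sum>k\<le>card A. of_nat (card A choose k) * (fact (card A - k) * y ^ k))"
    by (rule sum_Pow_card[OF A])
  also have "\<dots> = (\<Sum>k\<le>card A. fact (card A) * (y ^ k / fact k))"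
    by (rule sum.cong) (simp_all add: binomial_fact)
  finally show ?thesis by (simp add: sum_distrib_left)
qed

text \<open>Composition with the transposition of two elements reverses every sign.\<close>

lemma sum_sign_permutes:
  assumes "finite A" "a \<in> A" "b \<in> A" "a \<noteq> b"
  shows "(\<Sum>\<tau> | \<tau> permutes A. real_of_int (sign \<tau>)) = 0"
proof -
  let ?t = "transpose a b"
  have t: "?t permutes A" using assms by (simp add: permutes_swap_id)
  have inv: "?t \<circ> (?t \<circ> \<tau>) = \<tau>" for \<tau> by (simp add: fun_eq_iff)
  have "(\<Sum>\<tau> | \<tau> permutes A. real_of_int (sign \<tau>)) =
      (\<Sum>\<tau> | \<tau> permutes A. real_of_int (sign (?t \<circ> \<tau>)))"
    by (rule sum.reindex_bij_witness[of _ "\<lambda>\<tau>. ?t \<circ> \<tau>" "\<lambda>\<tau>. ?t \<circ> \<tau>"])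
      (use t in \<open>auto simp: inv intro: permutes_compose\<close>)
  also have "\<dots> = (\<Sum>\<tau> | \<tau> permutes A. - real_of_int (sign \<tau>))"
  proof (rule sum.cong[OF refl])
    fix \<tau> assume "\<tau> \<in> {\<tau>. \<tau> permutes A}"
    then have "permutation \<tau>" using assms(1) permutation_permutes by blast
    then show "real_of_int (sign (?t \<circ> \<tau>)) = - real_of_int (sign \<tau>)"
      using assms(4) by (simp add: sign_compose permutation_swap_id sign_swap_id)
  qed
  finally show ?thesis by (simp add: sum_negf)
qed

section \<open>The groups as sets of wreath coordinates\<close>

abbreviation root_sign :: "nat \<Rightarrow> (nat list \<Rightarrow> nat list) \<Rightarrow> real" where
  "root_sign d g \<equiv> real_of_int (sign (root_perm d g))"

lemma root_perm_E_group_1: "root_perm d ` E_group d (Suc 0) = {\<tau>. \<tau> permutes {1..d}}"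
  using root_perm_bij[of d] by (simp add: bij_betw_def)

lemma E_group_subset: "E_group d n \<subseteq> tree_aut d n"
  by (cases "(d, n)" rule: E_group.cases) auto

lemma finite_E_group: "finite (E_group d n)"
proof (rule finite_subset)
  show "E_group d n \<subseteq> {g. g permutes tree_verts d n}"
    using E_group_subset by (auto simp: tree_aut_def)
qed (simp add: finite_permutations finite_tree_verts)

text \<open>
  The coordinates \<open>\<sigma> i\<close> act on a tree of arbitrary depth \<open>n\<close> here, since \<^const>\<open>sgn2\<close> sees
  only their action on one-letter words.
\<close>

lemma sgn2_wreath_elt:
  assumes "\<tau> permutes {1..d}"
  shows "sgn2 d (wreath_elt d (Suc n) \<sigma> \<tau>) = sign \<tau> * (\<Prod>i\<in>{1..d}. sign (root_perm d (\<sigma> i)))"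
proof -
  let ?g = "restrict_aut d 2 (wreath_elt d (Suc n) \<sigma> \<tau>)"
  have "root_perm d ?g = \<tau>"
  proof
    fix l show "root_perm d ?g l = \<tau> l"
      using permutes_not_in[OF assms, of l]
      by (simp add: root_perm_def restrict_aut_def wreath_elt_def tree_verts_def)
  qed
  moreover have "root_perm d (section_at d 1 ?g i) = root_perm d (\<sigma> i)" if "i \<in> {1..d}" for i
    using that
    by (intro ext)
      (simp add: root_perm_def section_at_def restrict_aut_def wreath_elt_def tree_verts_def)
  ultimately show ?thesis by (simp add: sgn2_def sgn2_level2_def)
qed

text \<open>
  Coordinates are taken in the extensional function space: values of \<open>\<sigma>\<close> outside \<open>{1..d}\<close> have
  no influence on the automorphism and would destroy injectivity.
\<close>

lemma wreath_elt_bij_E_group: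
  "bij_betw (\<lambda>(\<tau>, \<sigma>). wreath_elt d (Suc n) \<sigma> \<tau>)
     {(\<tau>, \<sigma>). \<tau> permutes {1..d} \<and> \<sigma> \<in> {1..d} \<rightarrow>\<^sub>E E_group d (Suc n) \<and>
        sign \<tau> * (\<Prod>i\<in>{1..d}. sign (root_perm d (\<sigma> i))) = 1}
     (E_group d (Suc (Suc n)))" (is "bij_betw ?f ?D ?E")
  unfolding bij_betw_def
proof
  have aut: "\<sigma> l \<in> tree_aut d (Suc n)"
    if "\<sigma> \<in> {1..d} \<rightarrow>\<^sub>E E_group d (Suc n)" "l \<in> {1..d}" for \<sigma> l
    using that E_group_subset by blast
  show "inj_on ?f ?D"
  proof (rule inj_onI, clarify)
    fix \<tau> \<sigma> \<tau>' \<sigma>'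
    assume t: "\<tau> permutes {1..d}" "\<tau>' permutes {1..d}"
      and s: "\<sigma> \<in> {1..d} \<rightarrow>\<^sub>E E_group d (Suc n)" "\<sigma>' \<in> {1..d} \<rightarrow>\<^sub>E E_group d (Suc n)"
      and eq: "wreath_elt d (Suc n) \<sigma> \<tau> = wreath_elt d (Suc n) \<sigma>' \<tau>'"
    have "\<tau> = \<tau>'" using root_perm_wreath_elt[OF t(1)] root_perm_wreath_elt[OF t(2)] eq by metis
    moreover have "\<sigma> = \<sigma>'"
    proof (rule PiE_ext[OF s])
      fix l assume l: "l \<in> {1..d}"
      show "\<sigma> l = \<sigma>' l"
        using section_at_wreath_elt[of \<sigma> l d "Suc n" \<tau>] section_at_wreath_elt[of \<sigma>' l d "Suc n" \<tau>']
          aut[OF s(1) l] aut[OF s(2) l] l eq by simp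
    qed
    ultimately show "\<tau> = \<tau>' \<and> \<sigma> = \<sigma>'" by simp
  qed
  show "?f ` ?D = ?E"
  proof (intro equalityI subsetI)
    fix g assume "g \<in> ?f ` ?D"
    then obtain \<tau> \<sigma> where g: "g = wreath_elt d (Suc n) \<sigma> \<tau>" and t: "\<tau> permutes {1..d}"
      and s: "\<sigma> \<in> {1..d} \<rightarrow>\<^sub>E E_group d (Suc n)"
      and sg: "sign \<tau> * (\<Prod>i\<in>{1..d}. sign (root_perm d (\<sigma> i))) = 1" by auto
    have "g \<in> wreath d (Suc n) (E_group d (Suc n)) {\<tau>. \<tau> permutes {1..d}}"
      unfolding wreath_def using g t s by blast
    moreover have "g \<in> tree_aut d (Suc (Suc n))"
      using wreath_elt_tree_aut[OF aut[OF s] t] g by simp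
    moreover have "sgn2 d g = 1" using sgn2_wreath_elt[OF t] g sg by simp
    ultimately show "g \<in> ?E" by (simp add: root_perm_E_group_1[simplified])
  next
    fix g assume "g \<in> ?E"
    then have gw: "g \<in> wreath d (Suc n) (E_group d (Suc n)) {\<tau>. \<tau> permutes {1..d}}"
      and sg: "sgn2 d g = 1"
      by (simp_all add: root_perm_E_group_1[simplified])
    then obtain \<sigma> \<tau> where g: "g = wreath_elt d (Suc n) \<sigma> \<tau>" and t: "\<tau> permutes {1..d}"
      and s: "\<forall>l\<in>{1..d}. \<sigma> l \<in> E_group d (Suc n)" unfolding wreath_def by blast
    let ?s = "restrict \<sigma> {1..d}"
    have "wreath_elt d (Suc n) ?s \<tau> = g"
      unfolding g by (rule ext) (auto simp: wreath_elt_def tree_verts_Cons_iff split: list.split)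
    moreover have "(\<tau>, ?s) \<in> ?D"
      using t s sg sgn2_wreath_elt[OF t, of n \<sigma>] g by simp
    ultimately show "g \<in> ?f ` ?D" by force
  qed
qed

lemma abs_prod_sign: "\<bar>\<Prod>i\<in>A. sign (p i) :: int\<bar> = 1"
  by (induction A rule: infinite_finite_induct) (simp_all add: abs_mult)

text \<open>
  The indicator of the kernel of a sign character, as the average of the trivial character and
  the character itself.
\<close>

lemma of_bool_sign_eq_1:
  fixes s :: int
  assumes "\<bar>s\<bar> = 1"
  shows "2 * of_bool (s = 1) = (1 + real_of_int s)"
  using assms by (auto simp: abs_if split: if_splits)

text \<open>
  The main counting device. The weights are products over the coordinates, and after replacing
  the sign condition by its indicator \<open>(1 + s) / 2\<close> so is the summand, because \<open>s\<close> is
  multiplicative. Each of the two halves then factors into independent sums over \<open>E\<^sub>n\<close>.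
\<close>

lemma sum_E_group_Suc:
  fixes f :: "(nat \<Rightarrow> nat) \<Rightarrow> real"
    and h :: "(nat \<Rightarrow> nat) \<Rightarrow> nat \<Rightarrow> (nat list \<Rightarrow> nat list) \<Rightarrow> real"
  shows "2 * (\<Sum>g\<in>E_group d (Suc (Suc n)).
        f (root_perm d g) * (\<Prod>i\<in>{1..d}. h (root_perm d g) i (section_at d (Suc n) g i))) =
      (\<Sum>\<tau> | \<tau> permutes {1..d}. f \<tau> * (\<Prod>i\<in>{1..d}. \<Sum>\<sigma>\<in>E_group d (Suc n). h \<tau> i \<sigma>)) +
      (\<Sum>\<tau> | \<tau> permutes {1..d}. f \<tau> * sign \<tau> *
        (\<Prod>i\<in>{1..d}. \<Sum>\<sigma>\<in>E_group d (Suc n). root_sign d \<sigma> * h \<tau> i \<sigma>))"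
proof -
  let ?P = "{\<tau>. \<tau> permutes {1..d}}" and ?S = "{1..d} \<rightarrow>\<^sub>E E_group d (Suc n)"
  let ?F = "\<lambda>g. f (root_perm d g) * (\<Prod>i\<in>{1..d}. h (root_perm d g) i (section_at d (Suc n) g i))"
  let ?e = "\<lambda>\<tau> \<sigma>. sign \<tau> * (\<Prod>i\<in>{1..d}. sign (root_perm d (\<sigma> i)))"
  let ?D = "{(\<tau>, \<sigma>). \<tau> permutes {1..d} \<and> \<sigma> \<in> ?S \<and> ?e \<tau> \<sigma> = 1}"
  have fin: "finite (?P \<times> ?S)"
    by (intro finite_cartesian_product finite_permutations finite_PiE) (auto simp: finite_E_group)
  have "(\<Sum>g\<in>E_group d (Suc (Suc n)). ?F g) = (\<Sum>(\<tau>, \<sigma>)\<in>?D. ?F (wreath_elt d (Suc n) \<sigma> \<tau>))"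
    using sum.reindex_bij_betw[OF wreath_elt_bij_E_group[of d n], of ?F]
    by (simp add: case_prod_unfold)
  also have "\<dots> = (\<Sum>(\<tau>, \<sigma>)\<in>?D. f \<tau> * (\<Prod>i\<in>{1..d}. h \<tau> i (\<sigma> i)))"
  proof (rule sum.cong[OF refl], clarify)
    fix \<tau> \<sigma> assume t: "\<tau> permutes {1..d}" and s: "\<sigma> \<in> ?S"
    have "section_at d (Suc n) (wreath_elt d (Suc n) \<sigma> \<tau>) i = \<sigma> i" if "i \<in> {1..d}" for i
      using s that E_group_subset by (intro section_at_wreath_elt) blast+
    then show "?F (wreath_elt d (Suc n) \<sigma> \<tau>) = f \<tau> * (\<Prod>i\<in>{1..d}. h \<tau> i (\<sigma> i))"
      using t by (simp add: root_perm_wreath_elt)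
  qed
  also have "\<dots> = (\<Sum>(\<tau>, \<sigma>)\<in>?P \<times> ?S. of_bool (?e \<tau> \<sigma> = 1) * (f \<tau> * (\<Prod>i\<in>{1..d}. h \<tau> i (\<sigma> i))))"
    using fin by (intro sum.mono_neutral_cong_left) auto
  finally have "2 * (\<Sum>g\<in>E_group d (Suc (Suc n)). ?F g) = (\<Sum>(\<tau>, \<sigma>)\<in>?P \<times> ?S.
      (2 * of_bool (?e \<tau> \<sigma> = 1)) * (f \<tau> * (\<Prod>i\<in>{1..d}. h \<tau> i (\<sigma> i))))"
    by (simp add: sum_distrib_left case_prod_unfold mult.assoc)
  also have "\<dots> = (\<Sum>(\<tau>, \<sigma>)\<in>?P \<times> ?S. f \<tau> * (\<Prod>i\<in>{1..d}. h \<tau> i (\<sigma> i)) +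
      f \<tau> * sign \<tau> * (\<Prod>i\<in>{1..d}. root_sign d (\<sigma> i) * h \<tau> i (\<sigma> i)))"
  proof (rule sum.cong[OF refl], clarify)
    fix \<tau> :: "nat \<Rightarrow> nat" and \<sigma>
    have "\<bar>?e \<tau> \<sigma>\<bar> = 1" by (simp add: abs_mult abs_prod_sign)
    from of_bool_sign_eq_1[OF this]
    show "(2 * of_bool (?e \<tau> \<sigma> = 1)) * (f \<tau> * (\<Prod>i\<in>{1..d}. h \<tau> i (\<sigma> i))) =
      f \<tau> * (\<Prod>i\<in>{1..d}. h \<tau> i (\<sigma> i)) +
      f \<tau> * sign \<tau> * (\<Prod>i\<in>{1..d}. root_sign d (\<sigma> i) * h \<tau> i (\<sigma> i))"
      by (simp add: prod.distrib algebra_simps)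
  qed
  finally show ?thesis
    by (simp add: case_prod_unfold sum.distrib prod_sum_PiE finite_E_group
        sum_distrib_left sum.cartesian_product)
qed

text \<open>
  In the inductive step the unsigned half cancels since the signs of all permutations of
  \<open>{1..d}\<close> sum to zero; in the signed half, the sign of \<open>\<tau>\<close> occurs twice and disappears, and
  each coordinate contributes the sum of the previous level.
\<close>

lemma sum_root_sign_E_group:
  assumes "d \<ge> 2"
  shows "(\<Sum>g\<in>E_group d (Suc n). root_sign d g) = 0"
proof (induction n)
  have P: "(\<Sum>\<tau> | \<tau> permutes {1..d}. real_of_int (sign \<tau>)) = 0"
    by (rule sum_sign_permutes[of _ 1 2]) (use assms in auto)
  {
    case 0
    have "(\<Sum>g\<in>tree_aut d 1. root_sign d g) = (\<Sum>\<tau> | \<tau> permutes {1..d}. real_of_int (sign \<tau>))"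
      by (rule sum.reindex_bij_betw[OF root_perm_bij])
    then show ?case using P by simp
  next
    case (Suc n)
    have "2 * (\<Sum>g\<in>E_group d (Suc (Suc n)). root_sign d g) = 0"
      using sum_E_group_Suc[of "\<lambda>\<tau>. real_of_int (sign \<tau>)" d "\<lambda>_ _ _. 1" n] assms Suc.IH P
      by (simp add: sum_distrib_right[symmetric] del: E_group.simps)
    then show ?case by simp
  }
qed

text \<open>
  The signed half of the count vanishes, so exactly half of the wreath product satisfies the sign
  condition.
\<close>

lemma card_E_group_Suc:
  assumes "d \<ge> 2"
  shows "2 * real (card (E_group d (Suc (Suc n)))) = fact d * real (card (E_group d (Suc n))) ^ d"
  using sum_E_group_Suc[of "\<lambda>_. 1" d "\<lambda>_ _ _. 1" n] assms sum_root_sign_E_group[OF assms, of n]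
  by (simp add: card_permutations power_0_left del: E_group.simps)

lemma card_E_group_pos:
  assumes "d \<ge> 2"
  shows "card (E_group d (Suc n)) > 0"
proof (induction n)
  case 0
  have "root_perm d ` E_group d (Suc 0) \<noteq> {}"
    unfolding root_perm_E_group_1 using permutes_id by blast
  then show ?case using finite_E_group[of d "Suc 0"] by (simp add: card_gt_0_iff)
next
  case (Suc n)
  then have "fact d * real (card (E_group d (Suc n))) ^ d > 0" by simp
  then show ?case using card_E_group_Suc[OF assms, of n] by (simp del: E_group.simps)
qed

section \<open>The recursion for elements without a fixed leaf\<close>

definition fixes_leaf :: "nat \<Rightarrow> nat \<Rightarrow> (nat list \<Rightarrow> nat list) \<Rightarrow> bool" where
  "fixes_leaf d n g \<longleftrightarrow> (\<exists>v\<in>leaves d n. g v = v)"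

lemma leaves_Suc: "leaves d (Suc n) = {l # v | l v. l \<in> {1..d} \<and> v \<in> leaves d n}"
  unfolding leaves_def by (auto simp: tree_verts_def length_Suc_conv)

lemma fixes_leaf_Suc:
  assumes "g \<in> tree_aut d (Suc n)"
  shows "fixes_leaf d (Suc n) g \<longleftrightarrow>
    (\<exists>i\<in>{1..d}. root_perm d g i = i \<and> fixes_leaf d n (section_at d n g i))"
proof -
  have "g (l # v) = root_perm d g l # section_at d n g l v"
    if "l \<in> {1..d}" "v \<in> leaves d n" for l v
    using that by (intro tree_aut_Cons[OF assms]) (simp add: leaves_def tree_verts_Cons_iff)
  then show ?thesis unfolding fixes_leaf_def leaves_Suc by fastforce
qed

definition nofix_weight :: "nat \<Rightarrow> nat \<Rightarrow> real" where
  "nofix_weight d n = (\<Sum>g\<in>E_group d n. of_bool (\<not> fixes_leaf d n g))"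

definition nofix_signed :: "nat \<Rightarrow> nat \<Rightarrow> real" where
  "nofix_signed d n = (\<Sum>g\<in>E_group d n. root_sign d g * of_bool (\<not> fixes_leaf d n g))"

definition fix_ratio :: "nat \<Rightarrow> nat \<Rightarrow> real" where
  "fix_ratio d n = real (card (E_fix d n)) / real (card (E_group d n))"

lemma card_E_fix: "real (card (E_fix d n)) = (\<Sum>g\<in>E_group d n. of_bool (fixes_leaf d n g))"
proof -
  have "E_fix d n = E_group d n \<inter> {g. fixes_leaf d n g}"
    by (auto simp: E_fix_def fixes_leaf_def)
  then show ?thesis using finite_E_group by simp
qed

text \<open>
  Having no fixed leaf is a product condition on the coordinates: each letter fixed by \<open>\<tau>\<close> needs
  a section without fixed leaf, and the sections at the other letters are free. In the signed
  half a free section contributes the sum of all root signs, which is zero, so that only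
  \<open>\<tau> = id\<close> remains.
\<close>

lemma nofix_weight_Suc:
  assumes "d \<ge> 2"
  shows "2 * nofix_weight d (Suc (Suc n)) =
    (\<Sum>\<tau> | \<tau> permutes {1..d}. \<Prod>i\<in>{1..d}.
       if \<tau> i = i then nofix_weight d (Suc n) else real (card (E_group d (Suc n)))) +
    nofix_signed d (Suc n) ^ d"
proof -
  let ?E = "E_group d (Suc n)" and ?P = "{\<tau>. \<tau> permutes {1..d}}"
  let ?h = "\<lambda>\<tau> i \<sigma>. if \<tau> i = i then of_bool (\<not> fixes_leaf d (Suc n) \<sigma>) else (1::real)"
  let ?R = "nofix_signed d (Suc n)"
  have weight: "nofix_weight d (Suc (Suc n)) = (\<Sum>g\<in>E_group d (Suc (Suc n)).
      1 * (\<Prod>i\<in>{1..d}. ?h (root_perm d g) i (section_at d (Suc n) g i)))"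
    unfolding nofix_weight_def
  proof (rule sum.cong[OF refl])
    fix g assume "g \<in> E_group d (Suc (Suc n))"
    then have g: "g \<in> tree_aut d (Suc (Suc n))" using E_group_subset by blast
    show "of_bool (\<not> fixes_leaf d (Suc (Suc n)) g) =
        1 * (\<Prod>i\<in>{1..d}. ?h (root_perm d g) i (section_at d (Suc n) g i))"
    proof (cases "fixes_leaf d (Suc (Suc n)) g")
      case True
      then show ?thesis using fixes_leaf_Suc[OF g] by (force simp: prod_zero_iff)
    next
      case False
      then have "(\<Prod>i\<in>{1..d}. ?h (root_perm d g) i (section_at d (Suc n) g i)) = 1"
        using fixes_leaf_Suc[OF g] by (intro prod.neutral) auto
      then show ?thesis using False by simp
    qed
  qed
  have split: "2 * nofix_weight d (Suc (Suc n)) = (\<Sum>\<tau>\<in>?P. 1 * (\<Prod>i\<in>{1..d}. \<Sum>\<sigma>\<in>?E. ?h \<tau> i \<sigma>)) +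
      (\<Sum>\<tau>\<in>?P. 1 * real_of_int (sign \<tau>) * (\<Prod>i\<in>{1..d}. \<Sum>\<sigma>\<in>?E. root_sign d \<sigma> * ?h \<tau> i \<sigma>))"
    unfolding weight by (rule sum_E_group_Suc[of "\<lambda>_. 1" d ?h n])
  have unsigned: "(\<Sum>\<tau>\<in>?P. 1 * (\<Prod>i\<in>{1..d}. \<Sum>\<sigma>\<in>?E. ?h \<tau> i \<sigma>)) =
      (\<Sum>\<tau>\<in>?P. \<Prod>i\<in>{1..d}. if \<tau> i = i then nofix_weight d (Suc n) else real (card ?E))"
  proof -
    have "(\<Sum>\<sigma>\<in>?E. ?h \<tau> i \<sigma>) = (if \<tau> i = i then nofix_weight d (Suc n) else real (card ?E))"
      for \<tau> :: "nat \<Rightarrow> nat" and i by (simp add: nofix_weight_def)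
    then show ?thesis by simp
  qed
  have signed: "(\<Sum>\<tau>\<in>?P. 1 * real_of_int (sign \<tau>) * (\<Prod>i\<in>{1..d}. \<Sum>\<sigma>\<in>?E. root_sign d \<sigma> * ?h \<tau> i \<sigma>)) = ?R ^ d"
  proof -
    have "(\<Sum>\<sigma>\<in>?E. root_sign d \<sigma> * ?h \<tau> i \<sigma>) = (if \<tau> i = i then ?R else 0)"
      for \<tau> :: "nat \<Rightarrow> nat" and i
      using sum_root_sign_E_group[OF assms, of n] by (simp add: nofix_signed_def)
    then have "(\<Sum>\<tau>\<in>?P. 1 * real_of_int (sign \<tau>) * (\<Prod>i\<in>{1..d}. \<Sum>\<sigma>\<in>?E. root_sign d \<sigma> * ?h \<tau> i \<sigma>)) =
        (\<Sum>\<tau>\<in>?P. sign \<tau> * (\<Prod>i\<in>{1..d}. if \<tau> i = i then ?R else 0))" by simp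
    also have "\<dots> = (\<Sum>\<tau>\<in>{id}. sign \<tau> * (\<Prod>i\<in>{1..d}. if \<tau> i = i then ?R else 0))"
    proof (rule sum.mono_neutral_right)
      show "\<forall>\<tau>\<in>?P - {id}. sign \<tau> * (\<Prod>i\<in>{1..d}. if \<tau> i = i then ?R else 0) = 0"
      proof
        fix \<tau> assume "\<tau> \<in> ?P - {id}"
        then have t: "\<tau> permutes {1..d}" "\<tau> \<noteq> id" by auto
        then obtain i where "\<tau> i \<noteq> i" by (auto simp: fun_eq_iff)
        then have "i \<in> {1..d}" "\<tau> i \<noteq> i" using permutes_not_in[OF t(1)] by blast+
        then show "sign \<tau> * (\<Prod>i\<in>{1..d}. if \<tau> i = i then ?R else 0) = 0"
          by (force simp: prod_zero_iff)
      qed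
    qed (auto simp: finite_permutations permutes_id)
    finally show ?thesis by simp
  qed
  show ?thesis unfolding split unsigned signed ..
qed

lemma nofix_weight_eq:
  assumes "d \<ge> 2"
  shows "nofix_weight d (Suc n) = real (card (E_group d (Suc n))) * (1 - fix_ratio d (Suc n))"
proof -
  let ?E = "E_group d (Suc n)"
  have "nofix_weight d (Suc n) + real (card (E_fix d (Suc n))) = (\<Sum>g\<in>?E. 1)"
    unfolding nofix_weight_def card_E_fix sum.distrib[symmetric] by (rule sum.cong) auto
  then show ?thesis
    using card_E_group_pos[OF assms, of n]
    by (simp add: fix_ratio_def right_diff_distrib del: E_group.simps)
qed

text \<open>
  As the root signs of the whole group cancel, the elements without a fixed leaf carry the
  opposite sign sum of those with one, of which there are few.
\<close>

lemma abs_nofix_signed_le: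
  assumes "d \<ge> 2"
  shows "\<bar>nofix_signed d (Suc n)\<bar> \<le> real (card (E_group d (Suc n))) * fix_ratio d (Suc n)"
proof -
  let ?E = "E_group d (Suc n)"
  have "nofix_signed d (Suc n) + (\<Sum>g\<in>?E. root_sign d g * of_bool (fixes_leaf d (Suc n) g)) =
      (\<Sum>g\<in>?E. root_sign d g)"
    unfolding nofix_signed_def sum.distrib[symmetric] by (rule sum.cong) auto
  then have "\<bar>nofix_signed d (Suc n)\<bar> =
      \<bar>\<Sum>g\<in>?E. root_sign d g * of_bool (fixes_leaf d (Suc n) g)\<bar>"
    using sum_root_sign_E_group[OF assms, of n] by simp
  also have "\<dots> \<le> (\<Sum>g\<in>?E. \<bar>root_sign d g * of_bool (fixes_leaf d (Suc n) g)\<bar>)"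
    by (rule sum_abs)
  also have "\<dots> = (\<Sum>g\<in>?E. of_bool (fixes_leaf d (Suc n) g))"
    by (rule sum.cong) (simp_all add: abs_mult flip: of_int_abs)
  also have "\<dots> = real (card ?E) * fix_ratio d (Suc n)"
    using card_E_group_pos[OF assms, of n] card_E_fix[of d "Suc n"]
    by (simp add: fix_ratio_def del: E_group.simps)
  finally show ?thesis .
qed

lemma fix_ratio_bounds: "0 \<le> fix_ratio d n" "fix_ratio d n \<le> 1"
proof -
  have "card (E_fix d n) \<le> card (E_group d n)"
    by (rule card_mono[OF finite_E_group]) (auto simp: E_fix_def)
  then show "fix_ratio d n \<le> 1" by (simp add: fix_ratio_def divide_le_eq)
qed (simp add: fix_ratio_def)

text \<open>
  The recursion for the proportions. The number \<open>r\<close> is the average over the group of the root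
  sign, set to zero on elements fixing a leaf; the statement keeps only its size.
\<close>

lemma fix_ratio_Suc:
  assumes "d \<ge> 2"
  shows "\<exists>r. \<bar>r\<bar> \<le> fix_ratio d (Suc n) \<and> 1 - fix_ratio d (Suc (Suc n)) =
    (\<Sum>k\<le>d. (- fix_ratio d (Suc n)) ^ k / fact k) + r ^ d / fact d"
proof -
  let ?x = "fix_ratio d (Suc n)"
  define N where "N = real (card (E_group d (Suc n)))"
  define r where "r = nofix_signed d (Suc n) / N"
  have N: "N > 0" using card_E_group_pos[OF assms, of n] by (simp add: N_def)
  have Q: "nofix_weight d (Suc n) = N * (1 + - ?x)"
    using nofix_weight_eq[OF assms] by (simp add: N_def)
  have "fact d * N ^ d * (1 - fix_ratio d (Suc (Suc n))) = 2 * nofix_weight d (Suc (Suc n))"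
    using nofix_weight_eq[OF assms, of "Suc n"] card_E_group_Suc[OF assms, of n]
    by (simp add: N_def del: E_group.simps)
  also have "\<dots> = (\<Sum>\<tau> | \<tau> permutes {1..d}. \<Prod>i\<in>{1..d}. N * (if \<tau> i = i then 1 + - ?x else 1)) +
      (N * r) ^ d"
  proof -
    have "(if \<tau> i = i then nofix_weight d (Suc n) else real (card (E_group d (Suc n)))) =
        N * (if \<tau> i = i then 1 + - ?x else 1)" for \<tau> :: "nat \<Rightarrow> nat" and i
      by (simp add: Q N_def)
    moreover have "nofix_signed d (Suc n) = N * r" using N by (simp add: r_def)
    ultimately show ?thesis using nofix_weight_Suc[OF assms, of n] by simp
  qed
  also have "\<dots> = N ^ d * (\<Sum>\<tau> | \<tau> permutes {1..d}. \<Prod>i\<in>{1..d}. if \<tau> i = i then 1 + - ?x else 1) +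
      (N * r) ^ d"
    by (simp add: prod.distrib sum_distrib_left)
  also have "\<dots> = N ^ d * (fact d * (\<Sum>k\<le>d. (- ?x) ^ k / fact k)) + (N * r) ^ d"
    using sum_permutes_fixed_points[of "{1..d}" "- ?x"] by simp
  also have "\<dots> = fact d * N ^ d * ((\<Sum>k\<le>d. (- ?x) ^ k / fact k) + r ^ d / fact d)"
    by (simp add: power_mult_distrib algebra_simps)
  finally have "1 - fix_ratio d (Suc (Suc n)) = (\<Sum>k\<le>d. (- ?x) ^ k / fact k) + r ^ d / fact d"
    using N by simp
  moreover have "\<bar>r\<bar> \<le> ?x"
    using abs_nofix_signed_le[OF assms, of n] N
    by (simp add: r_def N_def abs_divide pos_divide_le_eq mult.commute)
  ultimately show ?thesis by blast
qed

section \<open>Quadratic decay\<close>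

text \<open>
  For \<open>0 \<le> x \<le> 1\<close> the exponential series of \<open>- x\<close> alternates with decreasing terms. After a
  partial sum of odd degree the remaining terms pair up to nonnegative contributions, so the
  partial sum of degree \<open>3\<close> is a lower bound for all later ones.
\<close>

lemma exp_partial_sum_lower:
  fixes x :: real
  assumes x: "0 \<le> x" "x \<le> 1" and "d \<ge> 3"
  shows "1 - x + x\<^sup>2 / 2 - x ^ 3 / 6 \<le> (\<Sum>k\<le>d. (- x) ^ k / fact k)"
proof -
  let ?P = "\<lambda>d. \<Sum>k\<le>d. (- x) ^ k / fact k"
  have odd: "1 - x + x\<^sup>2 / 2 - x ^ 3 / 6 \<le> ?P (2 * m + 3)" for m
  proof (induction m)
    case 0
    show ?case by (simp add: numeral_eq_Suc)
  next
    case (Suc m)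
    have "x ^ (2 * m + 5) / fact (2 * m + 5) \<le> x ^ (2 * m + 4) / fact (2 * m + 4)"
      using x by (intro frac_le power_decreasing fact_mono) auto
    moreover have "2 * Suc m + 3 = Suc (Suc (2 * m + 3))" by simp
    then have "?P (2 * Suc m + 3) = ?P (2 * m + 3) +
        (- x) ^ (2 * m + 4) / fact (2 * m + 4) + (- x) ^ (2 * m + 5) / fact (2 * m + 5)"
      by (simp only: sum.atMost_Suc) (simp add: numeral_eq_Suc)
    ultimately show ?case using Suc.IH by (simp add: power_minus_odd)
  qed
  define m where "m = (d - 3) div 2"
  have "d = 2 * m + 3 \<or> d = Suc (2 * m + 3) \<and> even d"
    using \<open>d \<ge> 3\<close> unfolding m_def by arith
  then show ?thesis
  proof
    assume "d = 2 * m + 3"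
    then show ?thesis using odd by blast
  next
    assume d: "d = Suc (2 * m + 3) \<and> even d"
    then have "0 \<le> (- x) ^ d / fact d" using x by simp
    moreover have "?P d = ?P (2 * m + 3) + (- x) ^ d / fact d" unfolding conjunct1[OF d] by (rule sum.atMost_Suc)
    ultimately show ?thesis using odd[of m] by linarith
  qed
qed

text \<open>
  The hypothesis \<open>d \<ge> 3\<close> enters through \<open>\<bar>r\<bar>\<^sup>d / d! \<le> x\<^sup>3 / 6\<close>. Together with the cubic
  Taylor term this costs at most \<open>x\<^sup>3 / 3 \<le> x\<^sup>2 / 3\<close>, which leaves \<open>1 / 2 - 1 / 3 = 1 / 6\<close> of the
  quadratic gain.
\<close>

lemma fix_ratio_decay:
  assumes "d \<ge> 3"
  shows "fix_ratio d (Suc (Suc n)) \<le> fix_ratio d (Suc n) - (fix_ratio d (Suc n))\<^sup>2 / 6"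
proof -
  define x where "x = fix_ratio d (Suc n)"
  have x: "0 \<le> x" "x \<le> 1" using fix_ratio_bounds by (simp_all add: x_def)
  have "d \<ge> 2" using assms by simp
  then obtain r where r: "\<bar>r\<bar> \<le> x" and
    rec: "1 - fix_ratio d (Suc (Suc n)) = (\<Sum>k\<le>d. (- x) ^ k / fact k) + r ^ d / fact d"
    using fix_ratio_Suc[of d n] unfolding x_def by blast
  have "\<bar>r ^ d / fact d\<bar> = \<bar>r\<bar> ^ d / fact d" by (simp add: power_abs)
  also have "\<dots> \<le> x ^ 3 / 6"
  proof (rule frac_le)
    have "\<bar>r\<bar> ^ d \<le> x ^ d" using r by (intro power_mono) auto
    also have "\<dots> \<le> x ^ 3" using x assms by (intro power_decreasing) auto
    finally show "\<bar>r\<bar> ^ d \<le> x ^ 3" .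
    show "(6::real) \<le> fact d" using fact_mono[OF assms, where ?'a = real] by (simp add: fact_numeral)
  qed (use x in auto)
  finally have "- (x ^ 3 / 6) \<le> r ^ d / fact d" by linarith
  moreover have "x ^ 3 \<le> x\<^sup>2" using x by (intro power_decreasing) auto
  ultimately show ?thesis
    using rec exp_partial_sum_lower[OF x assms] unfolding x_def[symmetric] by linarith
qed

text \<open>The sequence decreases to a limit \<open>L\<close>, and the step inequality passes to \<open>L \<le> L - c L\<^sup>2\<close>.\<close>

lemma quadratic_decay_tendsto_0:
  fixes x :: "nat \<Rightarrow> real"
  assumes c: "c > 0" and nonneg: "\<And>n. 0 \<le> x n" and step: "\<And>n. x (Suc n) \<le> x n - c * (x n)\<^sup>2"
  shows "x \<longlonglongrightarrow> 0"
proof -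
  have dec: "x (Suc n) \<le> x n" for n
    using step[of n] c by (smt (verit) mult_nonneg_nonneg zero_le_power2)
  then have "decseq x" by (simp add: decseq_Suc_iff)
  then obtain L where L: "x \<longlonglongrightarrow> L"
    using decseq_convergent[of x 0] nonneg by metis
  have "L \<le> L - c * L\<^sup>2"
  proof (rule LIMSEQ_le[OF LIMSEQ_Suc[OF L]])
    show "(\<lambda>n. x n - c * (x n)\<^sup>2) \<longlonglongrightarrow> L - c * L\<^sup>2" by (intro tendsto_intros L)
  qed (use step in blast)
  then have "L = 0" using c by (simp add: mult_le_0_iff)
  then show ?thesis using L by simp
qed

theorem theorem4p1p2:
  fixes d :: nat
  assumes "d \<ge> 3"
  shows "(\<lambda>n. real (card (E_fix d n)) / real (card (E_group d n))) \<longlonglongrightarrow> 0"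
proof -
  have "(\<lambda>n. fix_ratio d (Suc n)) \<longlonglongrightarrow> 0"
    using fix_ratio_decay[OF assms] fix_ratio_bounds(1)
    by (intro quadratic_decay_tendsto_0[of "1/6"]) simp_all
  then show ?thesis unfolding fix_ratio_def by (rule LIMSEQ_imp_Suc)
qed

end
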